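(* Let $X,Y$ be finite-dimensional locally finite simplicial complexes, each equipped with its standard metric. Then there exists $\epsilon(X,Y)>0$ such that the following holds for every $0<\epsilon<\epsilon(X,Y)$. If $f:X\to Y$ is a simplicial map that is an $\epsilon$-controlled homotopy equivalence $f:(X,f)\to (Y,\mathrm{id}_Y)$, then $f$ is homotopic to a map $f':X\to Y$ such that $f':(X,f')\to(Y,\mathrm{id}_Y)$ is a $Y$-triangular homotopy equivalence.
   Context: Standard metric: the standard $n$-simplex $\Delta^n\subset\mathbb{R}^{n+1}$ is the convex hull of the standard basis vectors $e_0,\dots,e_n$, with the metric induced from the Euclidean ($\ell_2$) metric. A locally finite finite-dimensional simplicial complex is given the path metric whose restriction to each $n$-simplex is this metric on $\Delta^n$ (points in different components have distance $\infty$). Controlled spaces: a space $X$ with a control map $p:X\to Y$ to a simplicial complex $Y$ is written $(X,p)$. A map $f:(X,p)\to(Z,q)$ is $Y$-triangular if $q(f(p^{-1}(\mathring\sigma)))\subset\sigma$ for every simplex $\sigma$ of $Y$ ($\mathring\sigma$ the open simplex). A homotopy $H:X\times[0,1]\to Z$ between maps $(X,p)\to(Z,q)$ is $Y$-triangular if $H:(X\times[0,1],p\circ \mathrm{pr}_1)\to(Z,q)$ is $Y$-triangular. A map $f:(X,p)\to(Z,q)$ is a $Y$-triangular homotopy equivalence if there are a map $g:Z\to X$ and homotopies $h_1:f\circ g\simeq\mathrm{id}_Z$, $h_2:g\circ f\simeq\mathrm{id}_X$ such that $f:(X,p)\to(Z,q)$, $g:(Z,q)\to(X,p)$, $h_1$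 (controlled via $q\circ\mathrm{pr}_1$) and $h_2$ (controlled via $p\circ\mathrm{pr}_1$) are all $Y$-triangular. If $Y$ carries a metric $d$, a map $f:(X,p)\to(Z,q)$ is $\epsilon$-controlled if $d(p(x),q(f(x)))<\epsilon$ for all $x\in X$; a homotopy is $\epsilon$-controlled if it is $\epsilon$-controlled as a map from $(X\times[0,1],p\circ\mathrm{pr}_1)$. A map $f:(X,p)\to(Z,q)$ is an $\epsilon$-controlled homotopy equivalence if there exist a homotopy inverse $g:Z\to X$ and homotopies $h_1:f\circ g\simeq \mathrm{id}_Z$, $h_2:g\circ f\simeq\mathrm{id}_X$ such that $f,g,h_1,h_2$ are all $\epsilon$-controlled. *)

theory Defs
  imports Complex_Main
begin

definition simplicial_complex :: "'v set set \<Rightarrow> bool" where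
  "simplicial_complex K \<longleftrightarrow>
     (\<forall>\<sigma>\<in>K. finite \<sigma> \<and> \<sigma> \<noteq> {}) \<and>
     (\<forall>\<sigma>\<in>K. \<forall>\<tau>. \<tau> \<subseteq> \<sigma> \<and> \<tau> \<noteq> {} \<longrightarrow> \<tau> \<in> K)"

definition locally_finite_complex :: "'v set set \<Rightarrow> bool" where
  "locally_finite_complex K \<longleftrightarrow> (\<forall>v. finite {\<sigma>\<in>K. v \<in> \<sigma>})"

definition finite_dimensional_complex :: "'v set set \<Rightarrow> bool" where
  "finite_dimensional_complex K \<longleftrightarrow> (\<exists>n::nat. \<forall>\<sigma>\<in>K. card \<sigma> \<le> n)"

definition supp :: "('v \<Rightarrow> real) \<Rightarrow> 'v set" where
  "supp x = {v. x v \<noteq> 0}"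

definition realization :: "'v set set \<Rightarrow> ('v \<Rightarrow> real) set" where
  "realization K = {x. (\<forall>v. 0 \<le> x v) \<and> supp x \<in> K \<and> sum x (supp x) = 1}"

text \<open>Euclidean (l2) distance of two points lying in a common simplex (standard metric
of the simplex, induced from R^(n+1)).\<close>
definition l2dist :: "('v \<Rightarrow> real) \<Rightarrow> ('v \<Rightarrow> real) \<Rightarrow> real" where
  "l2dist x y = sqrt (\<Sum>v\<in>supp x \<union> supp y. (x v - y v)\<^sup>2)"

text \<open>The standard (path) metric: d(x,y) is the infimum of the lengths of chains
x = p_0, ..., p_k = y with consecutive points in a common simplex (infinite if no chain
exists).  We only need the relation d(x,y) < e, which holds iff some chain has length < e.\<close>
definition path_dist_less :: "'v set set \<Rightarrow> ('v \<Rightarrow> real) \<Rightarrow> ('v \<Rightarrow> real) \<Rightarrow> real \<Rightarrow> bool" where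
  "path_dist_less K x y e \<longleftrightarrow>
     (\<exists>ps. ps \<noteq> [] \<and> hd ps = x \<and> last ps = y \<and> set ps \<subseteq> realization K \<and>
        (\<forall>i < length ps - 1. supp (ps ! i) \<union> supp (ps ! Suc i) \<in> K) \<and>
        (\<Sum>i < length ps - 1. l2dist (ps ! i) (ps ! Suc i)) < e)"

definition cont_map :: "'a set set \<Rightarrow> 'b set set \<Rightarrow> (('a \<Rightarrow> real) \<Rightarrow> ('b \<Rightarrow> real)) \<Rightarrow> bool" where
  "cont_map K L f \<longleftrightarrow>
     (\<forall>x\<in>realization K. f x \<in> realization L) \<and>
     (\<forall>x\<in>realization K. \<forall>e>0. \<exists>d>0. \<forall>y\<in>realization K.
        path_dist_less K x y d \<longrightarrow> path_dist_less L (f x) (f y) e)"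

definition cont_htpy :: "'a set set \<Rightarrow> 'b set set \<Rightarrow> (('a \<Rightarrow> real) \<Rightarrow> real \<Rightarrow> ('b \<Rightarrow> real)) \<Rightarrow> bool" where
  "cont_htpy K L H \<longleftrightarrow>
     (\<forall>x\<in>realization K. \<forall>t\<in>{0..1}. H x t \<in> realization L) \<and>
     (\<forall>x\<in>realization K. \<forall>t\<in>{0..1}. \<forall>e>0. \<exists>d>0. \<forall>y\<in>realization K. \<forall>s\<in>{0..1}.
        path_dist_less K x y d \<and> \<bar>s - t\<bar> < d \<longrightarrow> path_dist_less L (H x t) (H y s) e)"

definition homotopic_maps :: "'a set set \<Rightarrow> 'b set set \<Rightarrow> (('a \<Rightarrow> real) \<Rightarrow> ('b \<Rightarrow> real))
    \<Rightarrow> (('a \<Rightarrow> real) \<Rightarrow> ('b \<Rightarrow> real)) \<Rightarrow> bool" where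
  "homotopic_maps K L f g \<longleftrightarrow>
     (\<exists>H. cont_htpy K L H \<and> (\<forall>x\<in>realization K. H x 0 = f x \<and> H x 1 = g x))"

definition induced_map :: "('a \<Rightarrow> 'b) \<Rightarrow> ('a \<Rightarrow> real) \<Rightarrow> ('b \<Rightarrow> real)" where
  "induced_map \<phi> x = (\<lambda>w. \<Sum>v\<in>{v\<in>supp x. \<phi> v = w}. x v)"

definition simplicial_map :: "'a set set \<Rightarrow> 'b set set \<Rightarrow> (('a \<Rightarrow> real) \<Rightarrow> ('b \<Rightarrow> real)) \<Rightarrow> bool" where
  "simplicial_map K L f \<longleftrightarrow>
     (\<exists>\<phi>. (\<forall>\<sigma>\<in>K. \<phi> ` \<sigma> \<in> L) \<and> (\<forall>x\<in>realization K. f x = induced_map \<phi> x))"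

text \<open>Maps f : (X,p) -> (Z,q) with control maps p, q into |L|.  The homotopies
h1 : f o g ~ id_Z and h2 : g o f ~ id_X are controlled via q o pr1 and p o pr1.\<close>

definition eps_controlled_he ::
  "'a set set \<Rightarrow> (('a \<Rightarrow> real) \<Rightarrow> ('c \<Rightarrow> real)) \<Rightarrow> 'b set set \<Rightarrow> (('b \<Rightarrow> real) \<Rightarrow> ('c \<Rightarrow> real))
   \<Rightarrow> 'c set set \<Rightarrow> (('a \<Rightarrow> real) \<Rightarrow> ('b \<Rightarrow> real)) \<Rightarrow> real \<Rightarrow> bool" where
  "eps_controlled_he X p Z q L f \<epsilon> \<longleftrightarrow>
     cont_map X Z f \<and>
     (\<exists>g h1 h2. cont_map Z X g \<and> cont_htpy Z Z h1 \<and> cont_htpy X X h2 \<and>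
        (\<forall>z\<in>realization Z. h1 z 0 = f (g z) \<and> h1 z 1 = z) \<and>
        (\<forall>x\<in>realization X. h2 x 0 = g (f x) \<and> h2 x 1 = x) \<and>
        (\<forall>x\<in>realization X. path_dist_less L (p x) (q (f x)) \<epsilon>) \<and>
        (\<forall>z\<in>realization Z. path_dist_less L (q z) (p (g z)) \<epsilon>) \<and>
        (\<forall>z\<in>realization Z. \<forall>t\<in>{0..1}. path_dist_less L (q z) (q (h1 z t)) \<epsilon>) \<and>
        (\<forall>x\<in>realization X. \<forall>t\<in>{0..1}. path_dist_less L (p x) (p (h2 x t)) \<epsilon>))"

text \<open>L-triangularity of a single point pair: if a lies in the open simplex sigma of L,
then b lies in the closed simplex sigma.\<close>
definition tri_pt :: "'c set set \<Rightarrow> ('c \<Rightarrow> real) \<Rightarrow> ('c \<Rightarrow> real) \<Rightarrow> bool" where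
  "tri_pt L a b \<longleftrightarrow> (\<forall>\<sigma>\<in>L. supp a = \<sigma> \<longrightarrow> supp b \<subseteq> \<sigma>)"

definition triangular_he ::
  "'a set set \<Rightarrow> (('a \<Rightarrow> real) \<Rightarrow> ('c \<Rightarrow> real)) \<Rightarrow> 'b set set \<Rightarrow> (('b \<Rightarrow> real) \<Rightarrow> ('c \<Rightarrow> real))
   \<Rightarrow> 'c set set \<Rightarrow> (('a \<Rightarrow> real) \<Rightarrow> ('b \<Rightarrow> real)) \<Rightarrow> bool" where
  "triangular_he X p Z q L f \<longleftrightarrow>
     cont_map X Z f \<and>
     (\<exists>g h1 h2. cont_map Z X g \<and> cont_htpy Z Z h1 \<and> cont_htpy X X h2 \<and>
        (\<forall>z\<in>realization Z. h1 z 0 = f (g z) \<and> h1 z 1 = z) \<and>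
        (\<forall>x\<in>realization X. h2 x 0 = g (f x) \<and> h2 x 1 = x) \<and>
        (\<forall>x\<in>realization X. tri_pt L (p x) (q (f x))) \<and>
        (\<forall>z\<in>realization Z. tri_pt L (q z) (p (g z))) \<and>
        (\<forall>z\<in>realization Z. \<forall>t\<in>{0..1}. tri_pt L (q z) (q (h1 z t))) \<and>
        (\<forall>x\<in>realization X. \<forall>t\<in>{0..1}. tri_pt L (p x) (p (h2 x t))))"

end

theory Submission
  imports Defs "HOL-Analysis.Elementary_Metric_Spaces" "HOL-Analysis.Function_Topology" "HOL-Analysis.L2_Norm"
begin

text \<open>
Let \<open>r\<close> be the self-map of \<open>|Y|\<close> that replaces every barycentric coordinate \<open>y v\<close>
by \<open>max (y v - \<delta>) 0\<close> and renormalises, with \<open>\<delta>\<close> so small that some coordinate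
always exceeds it. If \<open>d(z, w) < \<epsilon> < \<delta>\<close>, a coordinate of \<open>w\<close> above \<open>\<delta>\<close> is a
nonzero coordinate of \<open>z\<close>, so \<open>r w\<close> lies in the carrier of \<open>z\<close>: composing with \<open>r\<close>
turns \<open>\<epsilon>\<close>-control into triangularity. Put \<open>f' = r \<circ> f\<close> and keep the inverse \<open>g\<close>;
\<open>f' g = r f g\<close> is deformed through \<open>r \<circ> h1\<close> to \<open>r\<close>, then linearly to the identity.

On the source, \<open>f\<close> being simplicial lets \<open>r\<close> lift to \<open>R\<close> with \<open>f R = r f\<close>. Then
\<open>g f' = g f R\<close> is deformed through \<open>h2 (R x)\<close> to \<open>R\<close>, then linearly to the identity.
If \<open>f x v \<le> \<delta>\<close>, then \<open>f (R x) v = 0\<close>, so the \<open>v\<close>-coordinate of the \<open>f\<close>-image stays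
below \<open>\<epsilon>\<close> along the first part and at most \<open>f x v\<close> along the second, and \<open>r\<close>
kills it throughout.
\<close>

section \<open>Points of the realization, their faces and segments\<close>

lemma realizationD:
  assumes "simplicial_complex K" "x \<in> realization K"
  shows "\<And>v. 0 \<le> x v" "supp x \<in> K" "finite (supp x)" "supp x \<noteq> {}" "sum x (supp x) = 1"
  using assms by (auto simp: realization_def simplicial_complex_def)

text \<open>Total mass 1 makes \<open>supp z\<close> nonempty, so closure of \<open>K\<close> under
  faces applies. The mass is summed over \<open>supp x\<close>, so that applications never have to
  compute \<open>supp z\<close>.\<close>

lemma realization_face:
  assumes K: "simplicial_complex K" "x \<in> realization K"
    and z: "\<And>v. 0 \<le> z v" "supp z \<subseteq> supp x" "sum z (supp x) = 1"
  shows "z \<in> realization K"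
proof -
  have "sum z (supp z) = sum z (supp x)"
    using z by (intro sum.mono_neutral_left realizationD[OF K]) (auto simp: supp_def)
  then have s: "sum z (supp z) = 1" using z by simp
  then have "supp z \<noteq> {}" by auto
  then have "supp z \<in> K"
    using K z realizationD(2)[OF K] unfolding simplicial_complex_def by blast
  with s z show ?thesis by (simp add: realization_def)
qed

lemma realization_segment:
  assumes K: "simplicial_complex K" "x \<in> realization K" "z \<in> realization K"
    and "supp z \<subseteq> supp x" "t \<in> {0..1}"
  shows "(\<lambda>v. (1 - t) * x v + t * z v) \<in> realization K"
proof (rule realization_face[OF K(1,2)])
  have "sum z (supp x) = sum z (supp z)"
    using assms by (intro sum.mono_neutral_right realizationD[OF K(1,2)]) (auto simp: supp_def)
  then show "(\<Sum>v\<in>supp x. (1 - t) * x v + t * z v) = 1"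
    using realizationD(5)[OF K(1,2)] realizationD(5)[OF K(1,3)]
    by (simp add: sum.distrib flip: sum_distrib_left)
  show "supp (\<lambda>v. (1 - t) * x v + t * z v) \<subseteq> supp x"
    using assms by (auto simp: supp_def)
  show "0 \<le> (1 - t) * x v + t * z v" for v
    using assms realizationD(1)[OF K(1,2)] realizationD(1)[OF K(1,3)] by simp
qed

section \<open>The path metric induces the topology of pointwise convergence\<close>

lemma path_dist_less_mono:
  assumes "path_dist_less K x y d" "d \<le> e"
  shows "path_dist_less K x y e"
  using assms(1) unfolding path_dist_less_def
  by (elim exE conjE, intro exI conjI) (assumption | use assms(2) in linarith)+

text \<open>Each link of a chain moves a coordinate by at most its l2 length, and the changes
  telescope. Metric control enters the main argument only through this bound.\<close>

lemma path_dist_less_coordinate: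
  assumes "simplicial_complex K" "path_dist_less K x y e"
  shows "\<bar>x v - y v\<bar> < e"
proof -
  obtain ps where ps: "ps \<noteq> []" "hd ps = x" "last ps = y"
    and K: "\<And>i. i < length ps - 1 \<Longrightarrow> supp (ps ! i) \<union> supp (ps ! Suc i) \<in> K"
    and len: "(\<Sum>i < length ps - 1. l2dist (ps ! i) (ps ! Suc i)) < e"
    using assms unfolding path_dist_less_def by blast
  have "\<bar>y v - x v\<bar> = \<bar>\<Sum>i < length ps - 1. (ps ! Suc i) v - (ps ! i) v\<bar>"
    unfolding sum_lessThan_telescope[of "\<lambda>i. (ps ! i) v"] ps(2)[symmetric] ps(3)[symmetric]
      hd_conv_nth[OF ps(1)] last_conv_nth[OF ps(1)] ..
  also have "\<dots> \<le> (\<Sum>i < length ps - 1. \<bar>(ps ! Suc i) v - (ps ! i) v\<bar>)"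
    by (rule sum_abs)
  also have "\<dots> \<le> (\<Sum>i < length ps - 1. l2dist (ps ! i) (ps ! Suc i))"
  proof (rule sum_mono)
    fix i assume "i \<in> {..<length ps - 1}"
    then have "supp (ps ! i) \<union> supp (ps ! Suc i) \<in> K" by (intro K) simp
    then have fin: "finite (supp (ps ! i) \<union> supp (ps ! Suc i))"
      using assms(1) unfolding simplicial_complex_def by blast
    define a b where "a = ps ! i" and "b = ps ! Suc i"
    \<comment> \<open>Absolute values inside \<open>L2_set\<close> do not change it, and they make
      the bound of an entry by the norm two-sided.\<close>
    have "\<bar>b v - a v\<bar> \<le> L2_set (\<lambda>v. \<bar>a v - b v\<bar>) (supp a \<union> supp b)"
    proof (cases "v \<in> supp a \<union> supp b")
      case True
      then show ?thesis
        using member_le_L2_set[OF fin[folded a_def b_def] True, of "\<lambda>v. \<bar>a v - b v\<bar>"] by simp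
    next
      case False
      then show ?thesis by (simp add: supp_def)
    qed
    then show "\<bar>(ps ! Suc i) v - (ps ! i) v\<bar> \<le> l2dist (ps ! i) (ps ! Suc i)"
      by (simp add: l2dist_def L2_set_def a_def b_def)
  qed
  finally show ?thesis using len by linarith
qed

text \<open>The mass outside the support of \<open>x\<close> is controlled by the
coordinates in that support, so finitely many coordinates suffice.\<close>

lemma path_dist_less_of_coordinates:
  assumes K: "simplicial_complex K" "x \<in> realization K" and e: "e > 0"
  obtains d where "d > 0"
    "\<And>z. z \<in> realization K \<Longrightarrow> (\<And>v. v \<in> supp x \<Longrightarrow> \<bar>z v - x v\<bar> < d) \<Longrightarrow> path_dist_less K x z e"
proof -
  define F where "F = supp x"
  note x = realizationD[OF K, folded F_def]
  \<comment> \<open>The first term keeps every vertex of \<open>x\<close> in \<open>supp z\<close>,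
    so that \<open>x\<close> and \<open>z\<close> share a simplex and \<open>[x, z]\<close> is a
    chain. The second bounds its length: \<open>F\<close> and its complement each contribute at most
    \<open>card F * d\<close>, and the \<open>+ 1\<close> makes the inequality strict.\<close>
  define d where "d = min (Min (x ` F)) (e / (2 * card F + 1))"
  have pos: "x v > 0" if "v \<in> F" for v
    using that x(1)[of v] by (simp add: F_def supp_def)
  have "d > 0" using x(3,4) pos e by (simp add: d_def)
  moreover have "path_dist_less K x z e"
    if z': "z \<in> realization K" and near: "\<And>v. v \<in> F \<Longrightarrow> \<bar>z v - x v\<bar> < d" for z
  proof -
    note z = realizationD[OF K(1) z']
    have sub: "F \<subseteq> supp z"
    proof
      fix v assume v: "v \<in> F"
      then have "d \<le> x v" using x(3) by (simp add: d_def min.coboundedI1)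
      then show "v \<in> supp z" using near[OF v] by (auto simp: supp_def)
    qed
    have "l2dist x z = L2_set (\<lambda>v. x v - z v) (supp z)"
      using sub by (simp add: l2dist_def L2_set_def F_def Un_absorb1)
    also have "\<dots> \<le> (\<Sum>v\<in>supp z. \<bar>x v - z v\<bar>)" by (rule L2_set_le_sum_abs)
    also have "\<dots> = (\<Sum>v\<in>supp z - F. \<bar>x v - z v\<bar>) + (\<Sum>v\<in>F. \<bar>x v - z v\<bar>)"
      by (rule sum.subset_diff[OF sub z(3)])
    also have "(\<Sum>v\<in>supp z - F. \<bar>x v - z v\<bar>) = sum z (supp z - F)"
      by (rule sum.cong) (use z(1) in \<open>auto simp: F_def supp_def\<close>)
    \<comment> \<open>Both points have mass 1, so what \<open>z\<close> gains outside
      \<open>F\<close> it loses on \<open>F\<close>.\<close>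
    also have "\<dots> = (\<Sum>v\<in>F. x v - z v)"
      using x(5) z(5) sum.subset_diff[OF sub z(3), of z] by (simp add: sum_subtractf)
    also have "\<dots> \<le> (\<Sum>v\<in>F. \<bar>x v - z v\<bar>)" by (rule sum_mono) simp
    also have "(\<Sum>v\<in>F. \<bar>x v - z v\<bar>) \<le> (\<Sum>v\<in>F. d)"
      by (rule sum_mono) (use near in \<open>force simp: abs_minus_commute\<close>)
    finally have "l2dist x z \<le> 2 * card F * d" by (simp add: mult_ac)
    also have "\<dots> < (2 * card F + 1) * d" using \<open>d > 0\<close> by simp
    also have "\<dots> \<le> (2 * card F + 1) * (e / (2 * card F + 1))"
      by (rule mult_left_mono) (simp_all add: d_def)
    also have "\<dots> = e" by simp
    finally have "l2dist x z < e" .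
    moreover have "supp x \<union> supp z \<in> K" using sub z(2) by (simp add: F_def Un_absorb1)
    ultimately show ?thesis
      unfolding path_dist_less_def using K z' by (intro exI[of _ "[x, z]"]) simp
  qed
  ultimately show ?thesis using that by (simp add: F_def)
qed

text \<open>Only the finitely many coordinates in \<open>supp x\<close> are constrained, which gives
  an open set of the product topology on functions.\<close>

lemma path_ball_contains_open:
  fixes x :: "'v \<Rightarrow> real"
  assumes "simplicial_complex K" "x \<in> realization K" "e > 0"
  shows "\<exists>U. open U \<and> x \<in> U \<and> (\<forall>z\<in>realization K \<inter> U. path_dist_less K x z e)"
proof -
  obtain d where d: "d > 0"
    "\<And>z. z \<in> realization K \<Longrightarrow> (\<And>v. v \<in> supp x \<Longrightarrow> \<bar>z v - x v\<bar> < d) \<Longrightarrow> path_dist_less K x z e"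
    using path_dist_less_of_coordinates[OF assms] by metis
  define U where "U = (\<Inter>v\<in>supp x. (\<lambda>z. z v) -` ball (x v) d)"
  have "open U" unfolding U_def
    by (intro open_INT ballI open_vimage realizationD[OF assms(1,2)])
       (auto intro: continuous_on_product_coordinates)
  then show ?thesis using d
    by (intro exI[of _ U]) (auto simp: U_def dist_real_def abs_minus_commute)
qed

text \<open>A basic open set of the product restricts finitely many coordinates, and the path
  distance bounds each of them.\<close>

lemma open_contains_path_ball:
  fixes U :: "('v \<Rightarrow> real) set"
  assumes "simplicial_complex K" "open U" "x \<in> U"
  shows "\<exists>d>0. \<forall>z. path_dist_less K x z d \<longrightarrow> z \<in> U"
proof -
  obtain X where X: "x \<in> (\<Pi>\<^sub>E i\<in>UNIV. X i)" "\<And>i. open (X i)"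
    "finite {i. X i \<noteq> UNIV}" "(\<Pi>\<^sub>E i\<in>UNIV. X i) \<subseteq> U"
    using product_topology_open_contains_basis[of "\<lambda>_. euclidean" UNIV U x] assms
    by (auto simp: open_fun_def)
  define J where "J = {i. X i \<noteq> UNIV}"
  have "\<exists>r>0. \<forall>y. dist y (x i) < r \<longrightarrow> y \<in> X i" for i
    using X(1,2) by (auto simp: open_dist PiE_def)
  then obtain r where r: "\<And>i. r i > 0" "\<And>i y. dist y (x i) < r i \<Longrightarrow> y \<in> X i" by metis
  \<comment> \<open>Inserting 1 keeps the minimum meaningful when no coordinate is
    restricted.\<close>
  define d where "d = Min (insert 1 (r ` J))"
  have "d > 0" using r X(3) by (simp add: d_def J_def)
  moreover have "z \<in> U" if "path_dist_less K x z d" for z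
  proof -
    have "z i \<in> X i" for i
    proof (cases "i \<in> J")
      case True
      then have "d \<le> r i" using X(3) by (simp add: d_def J_def)
      then show ?thesis
        using path_dist_less_coordinate[OF assms(1) that, of i] r(2)[of "z i" i]
        by (simp add: dist_real_def abs_minus_commute)
    qed (simp add: J_def)
    then show ?thesis using X(4) by auto
  qed
  ultimately show ?thesis by blast
qed

text \<open>Replaces the path metric by the product topology, where continuity can be checked one
  coordinate at a time.\<close>

lemma cont_map_iff:
  assumes K: "simplicial_complex K" and L: "simplicial_complex L"
  shows "cont_map K L f \<longleftrightarrow>
    (\<forall>x\<in>realization K. f x \<in> realization L) \<and> continuous_on (realization K) f"
proof (intro iffI conjI)
  assume *: "cont_map K L f"
  then show "\<forall>x\<in>realization K. f x \<in> realization L" by (simp add: cont_map_def)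
  show "continuous_on (realization K) f" unfolding continuous_on_topological
  proof (intro ballI allI impI)
    fix x B assume x: "x \<in> realization K" and "open B" "f x \<in> B"
    then obtain e where e: "e > 0" "\<And>z. path_dist_less L (f x) z e \<Longrightarrow> z \<in> B"
      using open_contains_path_ball[OF L] by blast
    then obtain d where d: "d > 0"
      "\<And>y. y \<in> realization K \<Longrightarrow> path_dist_less K x y d \<Longrightarrow> path_dist_less L (f x) (f y) e"
      using * x unfolding cont_map_def by meson
    then show "\<exists>A. open A \<and> x \<in> A \<and> (\<forall>y\<in>realization K. y \<in> A \<longrightarrow> f y \<in> B)"
      using path_ball_contains_open[OF K x d(1)] e by blast
  qed
next
  assume *: "(\<forall>x\<in>realization K. f x \<in> realization L) \<and> continuous_on (realization K) f"
  show "cont_map K L f" unfolding cont_map_def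
  proof (intro conjI ballI allI impI)
    fix x and e :: real assume x: "x \<in> realization K" and "e > 0"
    then obtain B where B: "open B" "f x \<in> B" "\<forall>z\<in>realization L \<inter> B. path_dist_less L (f x) z e"
      using path_ball_contains_open[OF L, of "f x" e] * by blast
    then obtain A where A: "open A" "x \<in> A" "\<forall>y\<in>realization K. y \<in> A \<longrightarrow> f y \<in> B"
      using * x unfolding continuous_on_topological by meson
    show "\<exists>d>0. \<forall>y\<in>realization K. path_dist_less K x y d \<longrightarrow> path_dist_less L (f x) (f y) e"
      using open_contains_path_ball[OF K A(1,2)] A B * by blast
  qed (use * in blast)
qed

text \<open>The uncurried form makes the product topology on space times interval available; a
  neighbourhood of \<open>(x, t)\<close> contains a product of a path ball and an interval.\<close>

lemma cont_htpy_iff: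
  assumes K: "simplicial_complex K" and L: "simplicial_complex L"
  shows "cont_htpy K L H \<longleftrightarrow>
    (\<forall>x\<in>realization K. \<forall>t\<in>{0..1}. H x t \<in> realization L) \<and>
    continuous_on (realization K \<times> {0..1}) (\<lambda>p. H (fst p) (snd p))"
proof (intro iffI conjI)
  assume *: "cont_htpy K L H"
  then show "\<forall>x\<in>realization K. \<forall>t\<in>{0..1}. H x t \<in> realization L" by (simp add: cont_htpy_def)
  show "continuous_on (realization K \<times> {0..1}) (\<lambda>p. H (fst p) (snd p))"
    unfolding continuous_on_topological
  proof (intro ballI allI impI)
    fix p B assume p: "p \<in> realization K \<times> {0..1}" and B: "open B" "H (fst p) (snd p) \<in> B"
    obtain x t where [simp]: "p = (x, t)" by (cases p)
    have x: "x \<in> realization K" "t \<in> {0..1}" using p by auto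
    obtain e where e: "e > 0" "\<And>z. path_dist_less L (H x t) z e \<Longrightarrow> z \<in> B"
      using open_contains_path_ball[OF L B] by auto
    then obtain d where d: "d > 0"
      "\<And>y s. y \<in> realization K \<Longrightarrow> s \<in> {0..1} \<Longrightarrow> path_dist_less K x y d \<and> \<bar>s - t\<bar> < d
        \<Longrightarrow> path_dist_less L (H x t) (H y s) e"
      using * x unfolding cont_htpy_def by meson
    obtain U where U: "open U" "x \<in> U" "\<forall>z\<in>realization K \<inter> U. path_dist_less K x z d"
      using path_ball_contains_open[OF K x(1) d(1)] by blast
    have "open (U \<times> ball t d)" using U(1) by (intro open_Times open_ball)
    moreover have "\<forall>q\<in>realization K \<times> {0..1}. q \<in> U \<times> ball t d \<longrightarrow> H (fst q) (snd q) \<in> B"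
    proof (intro ballI impI)
      fix q assume q: "q \<in> realization K \<times> {0..1}" "q \<in> U \<times> ball t d"
      then have "\<bar>snd q - t\<bar> < d" by (auto simp: dist_real_def)
      then show "H (fst q) (snd q) \<in> B" using q U(3) by (intro e(2) d(2)) auto
    qed
    ultimately show "\<exists>A. open A \<and> p \<in> A \<and>
        (\<forall>q\<in>realization K \<times> {0..1}. q \<in> A \<longrightarrow> H (fst q) (snd q) \<in> B)"
      using U d(1) by (intro exI[of _ "U \<times> ball t d"]) auto
  qed
next
  assume *: "(\<forall>x\<in>realization K. \<forall>t\<in>{0..1}. H x t \<in> realization L) \<and>
    continuous_on (realization K \<times> {0..1}) (\<lambda>p. H (fst p) (snd p))"
  show "cont_htpy K L H" unfolding cont_htpy_def
  proof (intro conjI ballI allI impI)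
    fix x and t e :: real assume x: "x \<in> realization K" "t \<in> {0..1}" and "e > 0"
    then obtain B where B: "open B" "H x t \<in> B" "\<forall>z\<in>realization L \<inter> B. path_dist_less L (H x t) z e"
      using path_ball_contains_open[OF L, of "H x t" e] * by blast
    have "(x, t) \<in> realization K \<times> {0..1}" "H (fst (x, t)) (snd (x, t)) \<in> B"
      using x B by auto
    then obtain A where A: "open A" "(x, t) \<in> A"
      "\<forall>q\<in>realization K \<times> {0..1}. q \<in> A \<longrightarrow> H (fst q) (snd q) \<in> B"
      using * B(1) unfolding continuous_on_topological by meson
    obtain U T where UT: "open U" "open T" "x \<in> U" "t \<in> T" "U \<times> T \<subseteq> A"
      using open_prod_elim[OF A(1,2)] by (metis mem_Times_iff fst_conv snd_conv)
    obtain d1 where d1: "d1 > 0" "\<forall>z. path_dist_less K x z d1 \<longrightarrow> z \<in> U"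
      using open_contains_path_ball[OF K UT(1,3)] by blast
    obtain d2 where d2: "d2 > 0" "\<forall>s. dist s t < d2 \<longrightarrow> s \<in> T"
      using UT(2,4) unfolding open_dist by blast
    have "\<forall>y\<in>realization K. \<forall>s\<in>{0..1}.
        path_dist_less K x y (min d1 d2) \<and> \<bar>s - t\<bar> < min d1 d2 \<longrightarrow> path_dist_less L (H x t) (H y s) e"
    proof (intro ballI impI)
      fix y s assume y: "y \<in> realization K" "s \<in> {0..1::real}"
        and n: "path_dist_less K x y (min d1 d2) \<and> \<bar>s - t\<bar> < min d1 d2"
      then have "y \<in> U" using d1(2) path_dist_less_mono[of K x y "min d1 d2" d1] by simp
      moreover have "s \<in> T" using n d2(2) by (simp add: dist_real_def)
      ultimately have "(y, s) \<in> A" using UT(5) by blast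
      then show "path_dist_less L (H x t) (H y s) e" using y A(3) B(3) * by force
    qed
    then show "\<exists>d>0. \<forall>y\<in>realization K. \<forall>s\<in>{0..1}.
        path_dist_less K x y d \<and> \<bar>s - t\<bar> < d \<longrightarrow> path_dist_less L (H x t) (H y s) e"
      using d1(1) d2(1) by (intro exI[of _ "min d1 d2"]) simp
  qed (use * in blast)
qed

section \<open>Operations on homotopies\<close>

text \<open>Pasting along the two closed halves of the cylinder; \<open>HG\<close> gives agreement
  at \<open>t = 1/2\<close>.\<close>

lemma cont_htpy_concat:
  assumes K: "simplicial_complex K" and L: "simplicial_complex L"
    and H: "cont_htpy K L H" and G: "cont_htpy K L G"
    and HG: "\<And>x. x \<in> realization K \<Longrightarrow> H x 1 = G x 0"
  shows "cont_htpy K L (\<lambda>x t. if t \<le> 1/2 then H x (2 * t) else G x (2 * t - 1))"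
  unfolding cont_htpy_iff[OF K L]
proof (intro conjI ballI)
  have cH: "continuous_on (realization K \<times> {0..1}) (\<lambda>p. H (fst p) (snd p))"
    and cG: "continuous_on (realization K \<times> {0..1}) (\<lambda>p. G (fst p) (snd p))"
    using H G by (simp_all add: cont_htpy_iff[OF K L])
  let ?D = "realization K \<times> {0..1::real}"
  have 1: "continuous_on {p \<in> ?D. snd p \<le> 1/2} (\<lambda>p. H (fst p) (2 * snd p))"
  proof -
    have "continuous_on {p \<in> ?D. snd p \<le> 1/2} (\<lambda>p. (fst p, 2 * snd p))"
      by (intro continuous_on_Pair continuous_on_fst continuous_on_mult continuous_on_snd
          continuous_on_const continuous_on_id)
    moreover have "(\<lambda>p. (fst p, 2 * snd p)) ` {p \<in> ?D. snd p \<le> 1/2} \<subseteq> ?D" by auto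
    ultimately show ?thesis using continuous_on_compose2[OF cH] by fastforce
  qed
  have 2: "continuous_on {p \<in> ?D. 1/2 \<le> snd p} (\<lambda>p. G (fst p) (2 * snd p - 1))"
  proof -
    have "continuous_on {p \<in> ?D. 1/2 \<le> snd p} (\<lambda>p. (fst p, 2 * snd p - 1))"
      by (intro continuous_on_Pair continuous_on_fst continuous_on_mult continuous_on_diff
          continuous_on_snd continuous_on_const continuous_on_id)
    moreover have "(\<lambda>p. (fst p, 2 * snd p - 1)) ` {p \<in> ?D. 1/2 \<le> snd p} \<subseteq> ?D" by auto
    ultimately show ?thesis using continuous_on_compose2[OF cG] by fastforce
  qed
  show "continuous_on ?D
      (\<lambda>p. if snd p \<le> 1/2 then H (fst p) (2 * snd p) else G (fst p) (2 * snd p - 1))"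
    by (rule continuous_on_cases_le[OF 1 2]) (use HG in \<open>auto intro: continuous_on_snd continuous_on_id simp: field_simps mult_2\<close>)
  show "(if t \<le> 1/2 then H x (2 * t) else G x (2 * t - 1)) \<in> realization L"
    if "x \<in> realization K" "t \<in> {0..1}" for x t
    using that H G by (auto simp: cont_htpy_def)
qed

text \<open>Each segment stays in the closed carrier of \<open>f x\<close>, and continuity is
  checked coordinatewise.\<close>

lemma cont_htpy_segment:
  assumes K: "simplicial_complex K" and L: "simplicial_complex L"
    and f: "cont_map K L f" and g: "cont_map K L g"
    and face: "\<And>x. x \<in> realization K \<Longrightarrow> supp (g x) \<subseteq> supp (f x)"
  shows "cont_htpy K L (\<lambda>x t v. (1 - t) * f x v + t * g x v)"
  unfolding cont_htpy_iff[OF K L]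
proof (intro conjI ballI)
  have c: "continuous_on (realization K \<times> {0..1::real}) (\<lambda>p. h (fst p) v)" if "cont_map K L h" for h v
  proof (rule continuous_on_product_then_coordinatewise)
    have "continuous_on (realization K) h" using that by (simp add: cont_map_iff[OF K L])
    then show "continuous_on (realization K \<times> {0..1::real}) (\<lambda>p. h (fst p))"
      by (rule continuous_on_compose2) (auto intro: continuous_on_fst continuous_on_id)
  qed
  have "continuous_on (realization K \<times> {0..1})
      (\<lambda>p. (1 - snd p) * f (fst p) v + snd p * g (fst p) v)" for v
    by (intro continuous_on_add continuous_on_mult continuous_on_diff continuous_on_snd
        continuous_on_const continuous_on_id c f g)
  then show "continuous_on (realization K \<times> {0..1})
      (\<lambda>p v. (1 - snd p) * f (fst p) v + snd p * g (fst p) v)"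
    by (rule continuous_on_coordinatewise_then_product)
  show "(\<lambda>v. (1 - t) * f x v + t * g x v) \<in> realization L"
    if "x \<in> realization K" "t \<in> {0..1}" for x t
    using that f g face by (intro realization_segment[OF L]) (auto simp: cont_map_def)
qed

text \<open>Segment homotopies run towards the smaller support, whereas those of an equivalence must
  end at the identity.\<close>

lemma cont_htpy_reverse:
  assumes K: "simplicial_complex K" and L: "simplicial_complex L" and H: "cont_htpy K L H"
  shows "cont_htpy K L (\<lambda>x t. H x (1 - t))"
proof -
  have cH: "continuous_on (realization K \<times> {0..1}) (\<lambda>p. H (fst p) (snd p))"
    using H by (simp add: cont_htpy_iff[OF K L])
  have "continuous_on (realization K \<times> {0..1::real}) (\<lambda>p. (fst p, 1 - snd p))"
    by (intro continuous_on_Pair continuous_on_fst continuous_on_diff continuous_on_snd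
        continuous_on_const continuous_on_id)
  moreover have "(\<lambda>p. (fst p, 1 - snd p)) ` (realization K \<times> {0..1::real}) \<subseteq> realization K \<times> {0..1}"
    by auto
  ultimately have "continuous_on (realization K \<times> {0..1}) (\<lambda>p. H (fst p) (1 - snd p))"
    using continuous_on_compose2[OF cH] by fastforce
  then show ?thesis using H by (auto simp: cont_htpy_iff[OF K L])
qed

lemma cont_htpy_post:
  assumes K: "simplicial_complex K" and L: "simplicial_complex L" and M: "simplicial_complex M"
    and "cont_htpy K L H" "cont_map L M r"
  shows "cont_htpy K M (\<lambda>x t. r (H x t))"
proof -
  have cH: "continuous_on (realization K \<times> {0..1}) (\<lambda>p. H (fst p) (snd p))"
    and cr: "continuous_on (realization L) r"
    and H: "(\<lambda>p. H (fst p) (snd p)) ` (realization K \<times> {0..1}) \<subseteq> realization L"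
    using assms by (auto simp: cont_htpy_iff cont_map_iff)
  show ?thesis
    unfolding cont_htpy_iff[OF K M]
    using continuous_on_compose2[OF cr cH H] H assms(5) by (auto simp: cont_map_def image_subset_iff)
qed

lemma cont_htpy_pre:
  assumes K: "simplicial_complex K" and L: "simplicial_complex L" and M: "simplicial_complex M"
    and "cont_map K L r" "cont_htpy L M H"
  shows "cont_htpy K M (\<lambda>x t. H (r x) t)"
proof -
  have cH: "continuous_on (realization L \<times> {0..1}) (\<lambda>p. H (fst p) (snd p))"
    and cr: "continuous_on (realization K) r" and r: "r ` realization K \<subseteq> realization L"
    using assms by (auto simp: cont_htpy_iff cont_map_iff)
  have "continuous_on (realization K \<times> {0..1::real}) (\<lambda>p. (r (fst p), snd p))"
    by (intro continuous_on_Pair continuous_on_compose2[OF cr] continuous_on_fst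
        continuous_on_snd continuous_on_id) auto
  moreover have "(\<lambda>p. (r (fst p), snd p)) ` (realization K \<times> {0..1::real}) \<subseteq> realization L \<times> {0..1}"
    using r by auto
  ultimately have "continuous_on (realization K \<times> {0..1}) (\<lambda>p. H (r (fst p)) (snd p))"
    using continuous_on_compose2[OF cH] by fastforce
  then show ?thesis using assms by (auto simp: cont_htpy_iff cont_map_def)
qed

section \<open>Shrinking small barycentric coordinates\<close>

text \<open>Normalising constant of the shrinking: dividing by it restores total mass 1.\<close>

definition excess :: "real \<Rightarrow> ('v \<Rightarrow> real) \<Rightarrow> real" where
  "excess \<delta> y = (\<Sum>v\<in>supp y. max (y v - \<delta>) 0)"

text \<open>The denominator \<open>max (y v) \<delta>\<close> agrees with \<open>y v\<close> wherever the
numerator is nonzero, and keeps the quotient continuous at \<open>y v = 0\<close>.\<close>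

definition shrink_factor :: "real \<Rightarrow> ('v \<Rightarrow> real) \<Rightarrow> 'v \<Rightarrow> real" where
  "shrink_factor \<delta> y v = max (y v - \<delta>) 0 / max (y v) \<delta> / excess \<delta> y"

text \<open>With \<open>\<phi> = id\<close> this is the self-map of the target; for general
  \<open>\<phi>\<close> it is the lift to the source. All vertices over one vertex get the same
  factor, which is what makes the lift compatible with the induced map.\<close>

definition shrink :: "real \<Rightarrow> ('u \<Rightarrow> 'v) \<Rightarrow> ('u \<Rightarrow> real) \<Rightarrow> 'u \<Rightarrow> real" where
  "shrink \<delta> \<phi> x = (\<lambda>u. x u * shrink_factor \<delta> (induced_map \<phi> x) (\<phi> u))"

text \<open>A common index set for points with different supports exhibits the induced map as linear
  along segments.\<close>

lemma induced_map_superset: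
  assumes "finite A" "supp x \<subseteq> A"
  shows "induced_map \<phi> x w = (\<Sum>u\<in>{u\<in>A. \<phi> u = w}. x u)"
  unfolding induced_map_def
  by (rule sum.mono_neutral_left) (use assms in \<open>auto simp: supp_def\<close>)

lemma induced_map_id [simp]: "induced_map id x = x"
proof
  fix w
  have "{v \<in> supp x. id v = w} = (if x w = 0 then {} else {w})" by (auto simp: supp_def)
  then show "induced_map id x w = x w" by (simp add: induced_map_def)
qed

text \<open>Nonnegativity rules out cancellation within a fibre of \<open>\<phi>\<close>.\<close>

lemma supp_induced_map:
  assumes "finite (supp x)" "\<And>u. 0 \<le> x u"
  shows "supp (induced_map \<phi> x) = \<phi> ` supp x"
  using assms by (auto simp: supp_def induced_map_def sum_nonneg_eq_0_iff)

text \<open>Summation by fibres of \<open>\<phi>\<close>. The weight 1 gives the mass of the image;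
  the weight \<open>shrink_factor\<close> gives the mass of the lifted shrinking.\<close>

lemma sum_induced_map:
  assumes "finite (supp x)"
  shows "(\<Sum>w\<in>\<phi> ` supp x. induced_map \<phi> x w * h w) = (\<Sum>u\<in>supp x. x u * h (\<phi> u))"
proof -
  have "(\<Sum>u\<in>supp x. x u * h (\<phi> u))
      = (\<Sum>w\<in>\<phi> ` supp x. \<Sum>u\<in>{u\<in>supp x. \<phi> u = w}. x u * h (\<phi> u))"
    by (rule sum.image_gen[OF assms])
  also have "\<dots> = (\<Sum>w\<in>\<phi> ` supp x. induced_map \<phi> x w * h w)"
    by (auto simp: induced_map_def sum_distrib_right intro!: sum.cong)
  finally show ?thesis ..
qed

lemma induced_map_in_realization:
  assumes K: "simplicial_complex K" "x \<in> realization K" and \<phi>: "\<forall>\<sigma>\<in>K. \<phi> ` \<sigma> \<in> L"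
  shows "induced_map \<phi> x \<in> realization L"
proof -
  note x = realizationD[OF K]
  have s: "supp (induced_map \<phi> x) = \<phi> ` supp x" by (rule supp_induced_map[OF x(3,1)])
  moreover have "0 \<le> induced_map \<phi> x v" for v
    by (simp add: induced_map_def sum_nonneg x)
  ultimately show ?thesis
    using \<phi> x(2,5) sum_induced_map[OF x(3), of \<phi> "\<lambda>_. 1"] by (simp add: realization_def)
qed

text \<open>Here \<open>n\<close> bounds the number of vertices of a simplex. Coordinates that are
  all at most \<open>\<delta>\<close> would sum to at most \<open>n * \<delta> < 1\<close>, so every
  point has a coordinate above \<open>\<delta>\<close>.\<close>

locale shrinking =
  fixes Y :: "'b set set" and \<delta> :: real and n :: nat
  assumes Y: "simplicial_complex Y" and card_le: "\<And>\<sigma>. \<sigma> \<in> Y \<Longrightarrow> card \<sigma> \<le> n"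
    and \<delta>: "\<delta> > 0" "n * \<delta> < 1"
begin

text \<open>Lowering at most \<open>n\<close> coordinates by \<open>\<delta>\<close> leaves mass at
  least \<open>1 - n * \<delta>\<close>, and cutting off at 0 only adds to it.\<close>

lemma excess_pos:
  assumes "y \<in> realization Y"
  shows "excess \<delta> y > 0"
proof -
  note y = realizationD[OF Y assms]
  have "card (supp y) * \<delta> \<le> n * \<delta>"
    using card_le[OF y(2)] \<delta> by (intro mult_right_mono) auto
  then have "0 < sum y (supp y) - card (supp y) * \<delta>" using \<delta> y(5) by linarith
  also have "\<dots> = (\<Sum>v\<in>supp y. y v - \<delta>)" by (simp add: sum_subtractf)
  also have "\<dots> \<le> excess \<delta> y" unfolding excess_def by (rule sum_mono) simp
  finally show ?thesis .
qed

lemma mult_shrink_factor: "y v * shrink_factor \<delta> y v = max (y v - \<delta>) 0 / excess \<delta> y"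
  using \<delta> by (auto simp: shrink_factor_def max_def)

lemma shrink_factor_nonneg: "0 \<le> shrink_factor \<delta> y v"
  using \<delta> unfolding shrink_factor_def excess_def
  by (intro divide_nonneg_nonneg sum_nonneg) auto

lemma supp_shrink_id:
  assumes "y \<in> realization Y"
  shows "supp (shrink \<delta> id y) = {v. \<delta> < y v}"
  using excess_pos[OF assms] by (auto simp: supp_def shrink_def mult_shrink_factor max_def)

lemma supp_shrink: "supp (shrink \<delta> \<phi> x) \<subseteq> supp x"
  by (auto simp: supp_def shrink_def)

text \<open>Near \<open>y\<close> the coordinates outside the support of \<open>y\<close> stay below
\<open>\<delta>\<close>, so \<open>excess\<close> is locally a sum over a fixed finite set.\<close>

lemma continuous_on_excess: "continuous_on (realization Y) (excess \<delta>)"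
  unfolding continuous_on_def
proof
  fix y assume y': "y \<in> realization Y"
  note y = realizationD[OF Y y']
  have coord: "((\<lambda>z. z v) \<longlongrightarrow> y v) (at y within realization Y)" for v
    using continuous_on_product_coordinates[of v, THEN continuous_on_subset, of "realization Y"] y'
    by (auto simp: continuous_on_def)
  have "((\<lambda>z. sum z (supp y)) \<longlongrightarrow> 1) (at y within realization Y)"
    using tendsto_sum[of "supp y" "\<lambda>v z. z v" y, OF coord] y(5) by simp
  \<comment> \<open>Once \<open>supp y\<close> carries more than \<open>1 - \<delta>\<close> of the
    mass of \<open>z\<close>, less than \<open>\<delta>\<close> is left for any other
    vertex.\<close>
  then have "\<forall>\<^sub>F z in at y within realization Y. sum z (supp y) > 1 - \<delta>"
    by (rule order_tendstoD) (use \<delta> in simp)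
  moreover have "\<forall>\<^sub>F z in at y within realization Y. z \<in> realization Y"
    by (simp add: eventually_at_filter)
  ultimately have "\<forall>\<^sub>F z in at y within realization Y.
      (\<Sum>v\<in>supp y. max (z v - \<delta>) 0) = excess \<delta> z"
  proof eventually_elim
    case (elim z)
    note z = realizationD[OF Y elim(2)]
    have small: "z v \<le> \<delta>" if "v \<notin> supp y" for v
    proof (rule ccontr)
      assume "\<not> z v \<le> \<delta>"
      then have "v \<in> supp z" using \<delta> by (auto simp: supp_def)
      have "sum z (insert v (supp y)) \<le> sum z (supp z \<union> supp y)"
        using \<open>v \<in> supp z\<close> y z by (intro sum_mono2) auto
      also have "\<dots> = sum z (supp z)"
        using y z by (intro sum.mono_neutral_right) (auto simp: supp_def)
      finally show False using that y z elim \<open>\<not> z v \<le> \<delta>\<close> by simp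
    qed
    have "(\<Sum>v\<in>supp y. max (z v - \<delta>) 0) = (\<Sum>v\<in>supp y \<union> supp z. max (z v - \<delta>) 0)"
      using small y z by (intro sum.mono_neutral_left) (auto simp: max_def)
    also have "\<dots> = excess \<delta> z"
      unfolding excess_def using \<delta> y z by (intro sum.mono_neutral_right) (auto simp: supp_def)
    finally show ?case .
  qed
  moreover have "((\<lambda>z. \<Sum>v\<in>supp y. max (z v - \<delta>) 0) \<longlongrightarrow> excess \<delta> y) (at y within realization Y)"
    unfolding excess_def by (intro tendsto_intros coord)
  ultimately show "(excess \<delta> \<longlongrightarrow> excess \<delta> y) (at y within realization Y)"
    by (rule Lim_transform_eventually[rotated])
qed

lemma continuous_on_shrink_factor: "continuous_on (realization Y) (\<lambda>y. shrink_factor \<delta> y v)"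
proof -
  have "max (y v) \<delta> \<noteq> 0" for y using \<delta> by (simp add: max_def)
  moreover have "excess \<delta> y \<noteq> 0" if "y \<in> realization Y" for y using excess_pos[OF that] by simp
  moreover have "continuous_on (realization Y) (\<lambda>y. y v)"
    by (rule continuous_on_subset[OF continuous_on_product_coordinates]) simp
  ultimately show ?thesis
    unfolding shrink_factor_def
    by (intro continuous_on_divide continuous_on_max continuous_on_diff continuous_on_const
        continuous_on_excess ballI) auto
qed

text \<open>Grouped by fibres, the coordinates of the lift sum to the normalised mass of the
  shrunken image, which is 1.\<close>

lemma cont_map_shrink:
  assumes X: "simplicial_complex X" and \<phi>: "\<forall>\<sigma>\<in>X. \<phi> ` \<sigma> \<in> Y"
    and cont: "cont_map X Y (induced_map \<phi>)"
  shows "cont_map X X (shrink \<delta> \<phi>)"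
  unfolding cont_map_iff[OF X X]
proof (intro conjI ballI)
  have "continuous_on (realization X) (\<lambda>x. shrink_factor \<delta> (induced_map \<phi> x) v)" for v
    using cont by (intro continuous_on_compose2[OF continuous_on_shrink_factor])
                  (auto simp: cont_map_iff[OF X Y])
  then show "continuous_on (realization X) (shrink \<delta> \<phi>)"
    unfolding shrink_def
    by (intro continuous_on_coordinatewise_then_product continuous_on_mult
        continuous_on_subset[OF continuous_on_product_coordinates]) auto
next
  fix x assume x': "x \<in> realization X"
  note x = realizationD[OF X x']
  define y where "y = induced_map \<phi> x"
  have y': "y \<in> realization Y"
    unfolding y_def by (rule induced_map_in_realization[OF X x' \<phi>])
  have "(\<Sum>u\<in>supp x. shrink \<delta> \<phi> x u) = (\<Sum>w\<in>supp y. y w * shrink_factor \<delta> y w)"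
    using sum_induced_map[OF x(3), of \<phi> "shrink_factor \<delta> y"] supp_induced_map[OF x(3,1), of \<phi>]
    by (simp add: shrink_def y_def)
  also have "\<dots> = excess \<delta> y / excess \<delta> y"
    by (simp add: mult_shrink_factor excess_def flip: sum_divide_distrib)
  also have "\<dots> = 1" using excess_pos[OF y'] by simp
  finally show "shrink \<delta> \<phi> x \<in> realization X"
    using x(1) by (intro realization_face[OF X x'] supp_shrink) (auto simp: shrink_def shrink_factor_nonneg)
qed

text \<open>This is where simpliciality of the map enters: shrinking on the target lifts to the source.\<close>

lemma induced_map_shrink:
  assumes "finite (supp x)"
  shows "induced_map \<phi> (shrink \<delta> \<phi> x) = shrink \<delta> id (induced_map \<phi> x)"
proof
  fix w
  have "induced_map \<phi> (shrink \<delta> \<phi> x) w = (\<Sum>u\<in>{u\<in>supp x. \<phi> u = w}. shrink \<delta> \<phi> x u)"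
    using assms supp_shrink by (rule induced_map_superset)
  also have "\<dots> = induced_map \<phi> x w * shrink_factor \<delta> (induced_map \<phi> x) w"
    unfolding induced_map_def[where x = x] sum_distrib_right by (rule sum.cong) (auto simp: shrink_def induced_map_def)
  finally show "induced_map \<phi> (shrink \<delta> \<phi> x) w = shrink \<delta> id (induced_map \<phi> x) w"
    by (simp add: shrink_def)
qed

lemma cont_map_shrink_id: "cont_map Y Y (shrink \<delta> id)"
  by (rule cont_map_shrink[OF Y]) (auto simp: cont_map_iff[OF Y Y] simp flip: id_def)

end

section \<open>Construction of the triangular equivalence\<close>

lemma cont_map_ident: "simplicial_complex K \<Longrightarrow> cont_map K K (\<lambda>x. x)"
  by (simp add: cont_map_iff)

lemma cont_map_compose:
  assumes "simplicial_complex K" "simplicial_complex L" "simplicial_complex M"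
    and "cont_map K L f" "cont_map L M g"
  shows "cont_map K M (\<lambda>x. g (f x))"
proof -
  have "continuous_on (realization L) g" "continuous_on (realization K) f"
    "f ` realization K \<subseteq> realization L"
    using assms by (auto simp: cont_map_iff)
  from continuous_on_compose2[OF this] show ?thesis
    using assms by (simp add: cont_map_iff)
qed

lemma tri_ptI: "supp b \<subseteq> supp a \<Longrightarrow> tri_pt L a b"
  by (simp add: tri_pt_def)

theorem theorem3p1:
  fixes X :: "'a set set" and Y :: "'b set set"
  assumes "simplicial_complex X" "locally_finite_complex X" "finite_dimensional_complex X"
      and "simplicial_complex Y" "locally_finite_complex Y" "finite_dimensional_complex Y"
  shows "\<exists>\<epsilon>0>0. \<forall>\<epsilon>. 0 < \<epsilon> \<and> \<epsilon> < \<epsilon>0 \<longrightarrow>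
           (\<forall>f. simplicial_map X Y f \<and> eps_controlled_he X f Y id Y f \<epsilon> \<longrightarrow>
              (\<exists>f'. homotopic_maps X Y f f' \<and> triangular_he X f' Y id Y f'))"
proof -
  note X = assms(1) and Y = assms(4)
  obtain n where n: "\<And>\<sigma>. \<sigma> \<in> Y \<Longrightarrow> card \<sigma> \<le> n"
    using assms(6) unfolding finite_dimensional_complex_def by blast
  \<comment> \<open>Chosen so that \<open>n * \<delta> < 1\<close>. The same \<open>\<delta>\<close>
    serves as the bound on \<open>\<epsilon>\<close> in the conclusion.\<close>
  define \<delta> where "\<delta> = 1 / (real n + 1)"
  interpret shrinking Y \<delta> n
    by unfold_locales (use Y n in \<open>auto simp: \<delta>_def field_simps\<close>)
  define r where "r = shrink \<delta> (id :: 'b \<Rightarrow> 'b)"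
  have r: "cont_map Y Y r" unfolding r_def by (rule cont_map_shrink_id)
  have r_in: "r y \<in> realization Y" if "y \<in> realization Y" for y
    using r that by (simp add: cont_map_def)
  have supp_r: "supp (r y) = {v. \<delta> < y v}" if "y \<in> realization Y" for y
    unfolding r_def by (rule supp_shrink_id[OF that])
  have r_face: "supp (r y) \<subseteq> supp y" for y
    unfolding r_def by (rule supp_shrink)
  have "\<exists>f'. homotopic_maps X Y f f' \<and> triangular_he X f' Y id Y f'"
    if \<epsilon>: "\<epsilon> < \<delta>" and simp_f: "simplicial_map X Y f" and he: "eps_controlled_he X f Y id Y f \<epsilon>" for \<epsilon> f
  proof -
    obtain \<phi> where \<phi>: "\<forall>\<sigma>\<in>X. \<phi> ` \<sigma> \<in> Y" and f_eq: "\<And>x. x \<in> realization X \<Longrightarrow> f x = induced_map \<phi> x"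
      using simp_f by (auto simp: simplicial_map_def)
    obtain g h1 h2 where f: "cont_map X Y f" and g: "cont_map Y X g"
      and h1: "cont_htpy Y Y h1" and h2: "cont_htpy X X h2"
      and h1_ends: "\<And>z. z \<in> realization Y \<Longrightarrow> h1 z 0 = f (g z)" "\<And>z. z \<in> realization Y \<Longrightarrow> h1 z 1 = z"
      and h2_ends: "\<And>x. x \<in> realization X \<Longrightarrow> h2 x 0 = g (f x)" "\<And>x. x \<in> realization X \<Longrightarrow> h2 x 1 = x"
      and g_ctl: "\<And>z. z \<in> realization Y \<Longrightarrow> path_dist_less Y z (f (g z)) \<epsilon>"
      and h1_ctl: "\<And>z t. z \<in> realization Y \<Longrightarrow> t \<in> {0..1} \<Longrightarrow> path_dist_less Y z (h1 z t) \<epsilon>"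
      and h2_ctl: "\<And>x t. x \<in> realization X \<Longrightarrow> t \<in> {0..1} \<Longrightarrow> path_dist_less Y (f x) (f (h2 x t)) \<epsilon>"
      using he unfolding eps_controlled_he_def id_apply by blast
    have f_in: "f x \<in> realization Y" if "x \<in> realization X" for x
      using f that by (simp add: cont_map_def)
    have squeeze: "supp (r w) \<subseteq> supp z"
      if "w \<in> realization Y" "path_dist_less Y z w \<epsilon>" for z w
    proof
      fix v assume "v \<in> supp (r w)"
      then have "\<delta> < w v" using supp_r that(1) by simp
      then show "v \<in> supp z"
        using path_dist_less_coordinate[OF Y that(2), of v] \<epsilon> by (auto simp: supp_def)
    qed

    have "cont_map X Y (induced_map \<phi>)"
      using f f_eq by (simp add: cont_map_def)
    define R where "R = shrink \<delta> \<phi>"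
    have R: "cont_map X X R"
      unfolding R_def by (rule cont_map_shrink[OF X \<phi> \<open>cont_map X Y (induced_map \<phi>)\<close>])
    have R_in: "R x \<in> realization X" if "x \<in> realization X" for x
      using R that by (simp add: cont_map_def)
    have fR: "f (R x) = r (f x)" if "x \<in> realization X" for x
      using f_eq[OF R_in[OF that]] f_eq[OF that] realizationD(3)[OF X that]
      by (simp add: R_def r_def induced_map_shrink)
    have R_face: "supp (R x) \<subseteq> supp x" for x
      unfolding R_def by (rule supp_shrink)

    define f' where "f' = (\<lambda>x. r (f x))"
    \<comment> \<open>The second halves are the segment homotopies to \<open>r\<close> and \<open>R\<close>, run backwards.\<close>
    define k1 where "k1 = (\<lambda>z t. if t \<le> 1/2 then r (h1 z (2 * t))
      else (\<lambda>v. (1 - (1 - (2 * t - 1))) * z v + (1 - (2 * t - 1)) * r z v))"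
    define k2 where "k2 = (\<lambda>x t. if t \<le> 1/2 then h2 (R x) (2 * t)
      else (\<lambda>u. (1 - (1 - (2 * t - 1))) * x u + (1 - (2 * t - 1)) * R x u))"

    have f': "cont_map X Y f'" unfolding f'_def by (rule cont_map_compose[OF X Y Y f r])
    have "cont_htpy X Y (\<lambda>x t v. (1 - t) * f x v + t * f' x v)"
      by (rule cont_htpy_segment[OF X Y f f']) (simp add: f'_def r_face)
    then have "homotopic_maps X Y f f'"
      unfolding homotopic_maps_def by (intro exI conjI) auto
    moreover have k1: "cont_htpy Y Y k1" unfolding k1_def
      by (rule cont_htpy_concat[OF Y Y cont_htpy_post[OF Y Y Y h1 r]
            cont_htpy_reverse[OF Y Y cont_htpy_segment[OF Y Y cont_map_ident[OF Y] r r_face]]])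
         (simp add: h1_ends)
    moreover have k2: "cont_htpy X X k2" unfolding k2_def
      by (rule cont_htpy_concat[OF X X cont_htpy_pre[OF X X X R h2]
            cont_htpy_reverse[OF X X cont_htpy_segment[OF X X cont_map_ident[OF X] R R_face]]])
         (simp add: h2_ends R_in)
    moreover have "k1 z 0 = f' (g z) \<and> k1 z 1 = z" if "z \<in> realization Y" for z
      using that by (simp add: k1_def f'_def h1_ends)
    \<comment> \<open>The homotopy \<open>h2 (R x)\<close> starts at \<open>g (f (R x))\<close>,
      which \<open>fR\<close> turns into \<open>g (f' x)\<close>.\<close>
    moreover have "k2 x 0 = g (f' x) \<and> k2 x 1 = x" if "x \<in> realization X" for x
      using that by (simp add: k2_def f'_def h2_ends R_in fR)
    moreover have "tri_pt Y z (f' (g z))" if "z \<in> realization Y" for z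
      unfolding f'_def using g_ctl[OF that] f_in g that
      by (intro tri_ptI squeeze) (auto simp: cont_map_def)
    moreover have "tri_pt Y z (k1 z t)" if "z \<in> realization Y" "t \<in> {0..1}" for z t
    proof (rule tri_ptI, cases "t \<le> 1/2")
      case True
      have "supp (r (h1 z (2 * t))) \<subseteq> supp z"
        using that True h1 by (intro squeeze h1_ctl) (auto simp: cont_htpy_def)
      then show "supp (k1 z t) \<subseteq> supp z" using True by (simp add: k1_def)
    next
      case False
      then show "supp (k1 z t) \<subseteq> supp z"
        using r_face[of z] by (auto simp: k1_def supp_def)
    qed
    moreover have "tri_pt Y (f' x) (f' (k2 x t))" if x: "x \<in> realization X" and t: "t \<in> {0..1}" for x t
    proof (rule tri_ptI)
      have k2_in: "k2 x t \<in> realization X" using k2 x t by (simp add: cont_htpy_def)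
      \<comment> \<open>By \<open>supp_r\<close> this is the contrapositive of the required
        inclusion of supports.\<close>
      have "f (k2 x t) v \<le> \<delta>" if v: "f x v \<le> \<delta>" for v
      proof -
        have rv: "r (f x) v = 0"
          using supp_r[OF f_in[OF x]] v by (force simp: supp_def)
        show ?thesis
        proof (cases "t \<le> 1/2")
          case True
          \<comment> \<open>Control is applied at \<open>R x\<close>, where the coordinate is 0, so
            it stays below \<open>\<epsilon>\<close>; at \<open>x\<close> it would only give a bound
            by \<open>\<delta> + \<epsilon>\<close>.\<close>
          have "\<bar>f (R x) v - f (h2 (R x) (2 * t)) v\<bar> < \<epsilon>"
            using t True by (intro path_dist_less_coordinate[OF Y] h2_ctl R_in x) auto
          then show ?thesis using True \<epsilon> rv by (simp add: fR x k2_def)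
        next
          case False
          \<comment> \<open>The weight of \<open>R x\<close>, falling from 1 at
            \<open>t = 1/2\<close> to 0 at \<open>t = 1\<close>.\<close>
          let ?s = "1 - (2 * t - 1)"
          note fin = realizationD(3)[OF X x]
          have "supp (k2 x t) \<subseteq> supp x"
            using False R_face[of x] by (auto simp: k2_def supp_def)
          then have "f (k2 x t) v = (\<Sum>u\<in>{u\<in>supp x. \<phi> u = v}. k2 x t u)"
            using f_eq[OF k2_in] induced_map_superset[OF fin] by simp
          also have "\<dots> = (1 - ?s) * (\<Sum>u\<in>{u\<in>supp x. \<phi> u = v}. x u) + ?s * (\<Sum>u\<in>{u\<in>supp x. \<phi> u = v}. R x u)"
            using False unfolding k2_def by (simp add: sum.distrib sum_distrib_left)
          also have "\<dots> = (1 - ?s) * f x v + ?s * f (R x) v"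
            unfolding f_eq[OF R_in[OF x]] f_eq[OF x] induced_map_superset[OF fin R_face]
              induced_map_superset[OF fin order_refl] ..
          also have "\<dots> = (1 - ?s) * f x v" using fR[OF x] rv by simp
          also have "\<dots> \<le> 1 * f x v"
            using False t realizationD(1)[OF Y f_in[OF x]] by (intro mult_right_mono) auto
          finally show ?thesis using v by simp
        qed
      qed
      then show "supp (f' (k2 x t)) \<subseteq> supp (f' x)"
        unfolding f'_def supp_r[OF f_in[OF k2_in]] supp_r[OF f_in[OF x]] by (auto simp: not_le[symmetric])
    qed
    \<comment> \<open>Triangularity of \<open>f'\<close> itself is immediate, since \<open>X\<close>
      is controlled by \<open>f'\<close>.\<close>
    ultimately have "homotopic_maps X Y f f' \<and> triangular_he X f' Y id Y f'"
      unfolding triangular_he_def id_apply using f' g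
      by (intro conjI exI[of _ g] exI[of _ k1] exI[of _ k2]) (auto simp: tri_ptI)
    then show ?thesis by blast
  qed
  then show ?thesis using \<delta>(1) by blast
qed

end
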